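(* Let $N$ be a positive integer and let $b,c,d,e'$ be complex parameters with $\Re(e'-N+b+c-2d)>0$. Then $$F_{1:1}^{0:3}\left[{-\atop d}:{-N,b,c\atop 1-N+b+c-d};{d+N,d-b,d-c\atop e'};1,1\right]=\frac{(d-b,\,d-c,\,1+d-e')_N}{(d,\,d-b-c,\,1+2d-b-c-e')_N}\cdot\frac{\Gamma(e')\,\Gamma(e'+b+c-2d)}{\Gamma(e'+b-d)\,\Gamma(e'+c-d)}.$$
   Context: $(x)_m=x(x+1)\cdots(x+m-1)$, $(x)_0=1$, is the Pochhammer symbol, and $(x_1,\dots,x_r)_m=(x_1)_m\cdots(x_r)_m$. The Kampé de Fériet series is $$F_{1:1}^{0:3}\left[{-\atop d}:{a,b,c\atop e};{a',b',c'\atop e'};x,y\right]=\sum_{m,n=0}^\infty\frac{(a,b,c)_m(a',b',c')_n}{(d)_{m+n}(e)_m(e')_n}\frac{x^my^n}{m!\,n!}.$$ It is absolutely convergent for $|x|=|y|=1$ when $\Re(d+e-a-b-c)>0$ and $\Re(d+e'-a'-b'-c')>0$. It is understood that no denominator parameter of the series (here $d$, $1-N+b+c-d$, $e'$) is zero or a negative integer; $1/\Gamma$ is taken to be $0$ at zero and the negative integers. *)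

theory Defs
  imports "HOL-Analysis.Analysis"
begin

text \<open>The parameters are listed in the order in which they occur in the symbol
  \<open>F[- / d : a,b,c / e; a',b',c' / e'; x,y]\<close>.\<close>

definition kampe_de_feriet_term ::
  "complex \<Rightarrow> complex \<Rightarrow> complex \<Rightarrow> complex \<Rightarrow> complex \<Rightarrow>
   complex \<Rightarrow> complex \<Rightarrow> complex \<Rightarrow> complex \<Rightarrow>
   complex \<Rightarrow> complex \<Rightarrow> nat \<times> nat \<Rightarrow> complex"
where
  "kampe_de_feriet_term d a b c e a' b' c' e' x y = (\<lambda>(m, n).
     (pochhammer a m * pochhammer b m * pochhammer c m) *
     (pochhammer a' n * pochhammer b' n * pochhammer c' n) /
     (pochhammer d (m + n) * pochhammer e m * pochhammer e' n) *
     (x ^ m * y ^ n / (fact m * fact n)))"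

text \<open>The double series is an unordered sum over all pairs. For complex terms, unordered
  summability is the same as absolute convergence; \<^const>\<open>infsum\<close> is \<open>0\<close> if the sum diverges.\<close>

definition kampe_de_feriet ::
  "complex \<Rightarrow> complex \<Rightarrow> complex \<Rightarrow> complex \<Rightarrow> complex \<Rightarrow>
   complex \<Rightarrow> complex \<Rightarrow> complex \<Rightarrow> complex \<Rightarrow>
   complex \<Rightarrow> complex \<Rightarrow> complex"
where
  "kampe_de_feriet d a b c e a' b' c' e' x y =
     (\<Sum>\<^sub>\<infinity>p. kampe_de_feriet_term d a b c e a' b' c' e' x y p)"

end

theory Submission
  imports Defs
begin

text \<open>
  The first factor \<open>(-N)\<^sub>m\<close> makes the series a finite sum of rows \<open>m \<le> N\<close>. Put \<open>\<delta> = d - b - c\<close>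
  and \<open>\<sigma> = 1 + 2d - b - c - e'\<close>. For \<open>m \<le> N\<close> the quotient \<open>(d + N)\<^sub>n / (d)\<^sub>m\<^sub>+\<^sub>n\<close> is
  \<open>(d + m + n)\<^sub>N\<^sub>-\<^sub>m / (d)\<^sub>N\<close>, a polynomial in \<open>n\<close>, so row \<open>m\<close> is a polynomial multiple of the
  Gauss series with parameters \<open>d - b, d - c; e'\<close>
  (\<open>kampe_de_feriet_term_eq_polynomial_times_gauss_term\<close>).

  Expanding the polynomial in the binomials \<open>n choose j\<close> (\<open>pochhammer_add_of_nat_sum\<close>) reduces
  the rows to binomial moments of that series. Each moment is again a Gauss series at \<open>1\<close>,
  with all three parameters raised by \<open>j\<close>, and equals the unshifted Gauss sum times
  \<open>(-1)\<^sup>j (d - b)\<^sub>j (d - c)\<^sub>j / (j! (\<sigma>)\<^sub>j)\<close> (\<open>gauss_binomial_moment_has_sum\<close>). This needs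
  \<open>Re (e' + b + c - 2d) > j\<close> for all \<open>j \<le> N\<close>, which is exactly the convergence hypothesis, and it
  also gives absolute convergence.

  What remains is a finite double sum over \<open>m\<close> and \<open>j\<close> (\<open>double_sum_identity\<close>). For fixed \<open>j\<close> the
  sum over \<open>m\<close> is a balanced \<open>\<^sub>3F\<^sub>2\<close> of degree \<open>N - j\<close>, because
  \<open>d + (1 - N + b + c - d) = 1 - N + b + c\<close>. The Pfaff-Saalschuetz formula sums it
  (\<open>saalschuetz_polynomial\<close>), and the remaining sum over \<open>j\<close> is a Chu-Vandermonde sum
  (\<open>pochhammer_diff_sum\<close>) with value \<open>(\<sigma> - \<delta>)\<^sub>N / (\<sigma>)\<^sub>N\<close>, where \<open>\<sigma> - \<delta> = 1 + d - e'\<close>.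

  Gauss's theorem (\<open>gauss_has_sum\<close>) is proved by iterating the contiguous relation in \<open>c\<close>.
\<close>

section \<open>Terminating summation formulas\<close>

text \<open>The Chu-Vandermonde formula with denominators cleared: reflecting
  \<open>(x + j)\<^sub>n\<^sub>-\<^sub>j\<close> to \<open>(1 - x - n)\<^sub>n\<^sub>-\<^sub>j\<close> turns it into the binomial theorem for Pochhammer symbols.\<close>

lemma pochhammer_diff_sum:
  fixes x y :: "'a::comm_ring_1"
  shows "pochhammer (x - y) n =
    (\<Sum>j\<le>n. (-1) ^ j * of_nat (n choose j) * pochhammer y j * pochhammer (x + of_nat j) (n - j))"
proof -
  have reflect: "pochhammer (1 - x - of_nat n) (n - j) =
      (-1) ^ (n - j) * pochhammer (x + of_nat j) (n - j)" if "j \<le> n" for j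
    using pochhammer_minus[of "x + of_nat n - 1" "n - j"] that
    by (simp add: of_nat_diff algebra_simps)
  have sgn: "(-1) ^ n * (-1) ^ (n - j) = (-1::'a) ^ j" if "j \<le> n" for j
    using that by (simp add: power_add[symmetric] minus_one_power_iff)
  have "pochhammer (x - y) n = (-1) ^ n * pochhammer (y + (1 - x - of_nat n)) n"
    using pochhammer_minus[of "y - x" n] by (simp add: algebra_simps)
  also have "\<dots> = (\<Sum>j\<le>n. ((-1) ^ n * (-1) ^ (n - j)) * of_nat (n choose j) *
      pochhammer y j * pochhammer (x + of_nat j) (n - j))"
    unfolding pochhammer_binomial_sum[of y "1 - x - of_nat n" n] sum_distrib_left
    by (intro sum.cong refl) (simp add: reflect mult_ac)
  also have "\<dots> = (\<Sum>j\<le>n. (-1) ^ j * of_nat (n choose j) *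
      pochhammer y j * pochhammer (x + of_nat j) (n - j))"
    by (intro sum.cong refl) (simp add: sgn)
  finally show ?thesis .
qed

text \<open>The case \<open>y = -n\<close>, in which \<open>(-1)\<^sup>j (y)\<^sub>j\<close> is the falling factorial
  \<open>n (n-1) \<dots> (n-j+1)\<close>. It expands a polynomial in \<open>n\<close> in the basis of binomials.\<close>

lemma pochhammer_add_of_nat_sum:
  fixes x :: "'a::field_char_0"
  shows "pochhammer (x + of_nat n) k =
    (\<Sum>j\<le>k. of_nat (k choose j) * fact j * of_nat (n choose j) * pochhammer (x + of_nat j) (k - j))"
proof -
  have "(-1) ^ j * pochhammer (- of_nat n :: 'a) j = fact j * of_nat (n choose j)" for j
    by (simp add: binomial_gbinomial gbinomial_pochhammer)
  then show ?thesis
    using pochhammer_diff_sum[of x "- of_nat n" k]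
    by (simp add: mult_ac)
qed

text \<open>The Pfaff-Saalschuetz sum of \<open>\<^sub>3F\<^sub>2(-n, a, b; c, 1 + a + b - c - n; 1)\<close>, multiplied by
  \<open>(c)\<^sub>n (c - a - b)\<^sub>n\<close>. This is a polynomial identity, which also covers the
  parameters for which a denominator of the series vanishes.

  It follows by applying the binomial theorem for Pochhammer symbols three times: to \<open>(c - b)\<^sub>n\<close> with
  \<open>c - b = a + (c - a - b)\<close>; to the last \<open>j\<close> factors of \<open>(c - a)\<^sub>n\<close>, with \<open>c - a = b + (c - a - b)\<close>
  shifted by \<open>n - j\<close>, which extends \<open>(c - a - b)\<^sub>n\<^sub>-\<^sub>j\<close> to \<open>(c - a - b)\<^sub>n\<^sub>-\<^sub>i\<close>; and, after the exchange
  of the two sums, backwards to the sum over \<open>j\<close>, with \<open>c + i = (a + i) + (c - a)\<close>.\<close>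

lemma saalschuetz_polynomial:
  fixes a b c :: "'a::comm_ring_1"
  shows "(\<Sum>k\<le>n. of_nat (n choose k) * pochhammer a k * pochhammer b k *
      pochhammer (c + of_nat k) (n - k) * pochhammer (c - a - b) (n - k)) =
    pochhammer (c - a) n * pochhammer (c - b) n"
proof -
  have split: "pochhammer (c - a - b) (n - j) * pochhammer (c - a) n =
      (\<Sum>i\<le>n. of_nat (j choose i) * pochhammer b i * pochhammer (c - a - b) (n - i) *
        pochhammer (c - a) (n - j))" (is "?l = ?r") if "j \<le> n" for j
  proof -
    have "pochhammer (c - a) n = pochhammer (c - a) (n - j) * pochhammer (b + (c - a - b + of_nat (n - j))) j"
      using pochhammer_product[of "n - j" n "c - a"] that by (simp add: algebra_simps)
    also have "\<dots> = pochhammer (c - a) (n - j) * (\<Sum>i\<le>j. of_nat (j choose i) * pochhammer b i *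
        pochhammer (c - a - b + of_nat (n - j)) (j - i))"
      by (simp only: pochhammer_binomial_sum[of b "c - a - b + of_nat (n - j)" j])
    finally have "?l = (\<Sum>i\<le>j. of_nat (j choose i) * pochhammer b i *
        (pochhammer (c - a - b) (n - j) * pochhammer (c - a - b + of_nat (n - j)) (j - i)) *
        pochhammer (c - a) (n - j))"
      by (simp add: sum_distrib_left mult_ac)
    also have "\<dots> = (\<Sum>i\<le>j. of_nat (j choose i) * pochhammer b i * pochhammer (c - a - b) (n - i) *
        pochhammer (c - a) (n - j))"
    proof (intro sum.cong refl)
      fix i assume "i \<in> {..j}"
      then have "pochhammer (c - a - b) (n - j) * pochhammer (c - a - b + of_nat (n - j)) (j - i) =
          pochhammer (c - a - b) (n - i)"
        using that pochhammer_product'[of "c - a - b" "n - j" "j - i"] by simp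
      then show "of_nat (j choose i) * pochhammer b i *
          (pochhammer (c - a - b) (n - j) * pochhammer (c - a - b + of_nat (n - j)) (j - i)) *
          pochhammer (c - a) (n - j) = of_nat (j choose i) * pochhammer b i *
          pochhammer (c - a - b) (n - i) * pochhammer (c - a) (n - j)"
        by simp
    qed
    also have "\<dots> = ?r"
      using that by (intro sum.mono_neutral_left ballI) (simp_all add: binomial_eq_0)
    finally show ?thesis .
  qed
  have inner: "(\<Sum>j\<le>n. of_nat ((n choose j) * (j choose i)) * pochhammer a j * pochhammer (c - a) (n - j)) =
      of_nat (n choose i) * pochhammer a i * pochhammer (c + of_nat i) (n - i)" (is "?l = ?r")
    if "i \<le> n" for i
  proof -
    have "?l = (\<Sum>j\<in>{i..n}. of_nat ((n choose j) * (j choose i)) * pochhammer a j * pochhammer (c - a) (n - j))"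
      by (intro sum.mono_neutral_right) (auto simp: not_le binomial_eq_0)
    also have "\<dots> = (\<Sum>k\<le>n - i. of_nat ((n choose (k + i)) * ((k + i) choose i)) *
        pochhammer a (k + i) * pochhammer (c - a) (n - (k + i)))"
      using that by (intro sum.reindex_bij_witness[of _ "\<lambda>k. k + i" "\<lambda>j. j - i"]) auto
    also have "\<dots> = (\<Sum>k\<le>n - i. of_nat (n choose i) * pochhammer a i *
        (of_nat ((n - i) choose k) * pochhammer (a + of_nat i) k * pochhammer (c - a) (n - i - k)))"
    proof (intro sum.cong refl)
      fix k assume "k \<in> {..n - i}"
      then have "(n choose (k + i)) * ((k + i) choose i) = (n choose i) * ((n - i) choose k)"
        using choose_mult[of i "k + i" n] that by simp
      then show "of_nat ((n choose (k + i)) * ((k + i) choose i)) * pochhammer a (k + i) *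
          pochhammer (c - a) (n - (k + i)) = of_nat (n choose i) * pochhammer a i *
          (of_nat ((n - i) choose k) * pochhammer (a + of_nat i) k * pochhammer (c - a) (n - i - k))"
        using pochhammer_product'[of a i k] by (simp add: add.commute mult_ac)
    qed
    also have "\<dots> = of_nat (n choose i) * pochhammer a i * pochhammer ((a + of_nat i) + (c - a)) (n - i)"
      by (simp only: pochhammer_binomial_sum[of "a + of_nat i" "c - a" "n - i"] sum_distrib_left)
    finally show ?thesis by (simp add: add.commute)
  qed
  have "pochhammer (c - a) n * pochhammer (c - b) n =
      pochhammer (c - a) n * pochhammer (a + (c - a - b)) n"
    by (simp add: algebra_simps)
  also have "\<dots> = (\<Sum>j\<le>n. of_nat (n choose j) * pochhammer a j *
      (pochhammer (c - a - b) (n - j) * pochhammer (c - a) n))"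
    by (simp only: pochhammer_binomial_sum[of a "c - a - b" n] sum_distrib_left mult_ac)
  also have "\<dots> = (\<Sum>j\<le>n. \<Sum>i\<le>n. pochhammer b i * pochhammer (c - a - b) (n - i) *
      (of_nat ((n choose j) * (j choose i)) * pochhammer a j * pochhammer (c - a) (n - j)))"
  proof (intro sum.cong refl)
    fix j assume "j \<in> {..n}"
    then have "j \<le> n" by simp
    show "of_nat (n choose j) * pochhammer a j * (pochhammer (c - a - b) (n - j) * pochhammer (c - a) n) =
        (\<Sum>i\<le>n. pochhammer b i * pochhammer (c - a - b) (n - i) *
          (of_nat ((n choose j) * (j choose i)) * pochhammer a j * pochhammer (c - a) (n - j)))"
      unfolding split[OF \<open>j \<le> n\<close>] sum_distrib_left of_nat_mult
      by (intro sum.cong refl) (simp only: mult_ac)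
  qed
  also have "\<dots> = (\<Sum>i\<le>n. pochhammer b i * pochhammer (c - a - b) (n - i) *
      (\<Sum>j\<le>n. of_nat ((n choose j) * (j choose i)) * pochhammer a j * pochhammer (c - a) (n - j)))"
    by (subst sum.swap) (simp add: sum_distrib_left)
  also have "\<dots> = (\<Sum>k\<le>n. of_nat (n choose k) * pochhammer a k * pochhammer b k *
      pochhammer (c + of_nat k) (n - k) * pochhammer (c - a - b) (n - k))"
  proof (intro sum.cong refl)
    fix i assume "i \<in> {..n}"
    then have "i \<le> n" by simp
    show "pochhammer b i * pochhammer (c - a - b) (n - i) *
        (\<Sum>j\<le>n. of_nat ((n choose j) * (j choose i)) * pochhammer a j * pochhammer (c - a) (n - j)) =
        of_nat (n choose i) * pochhammer a i * pochhammer b i *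
        pochhammer (c + of_nat i) (n - i) * pochhammer (c - a - b) (n - i)"
      unfolding inner[OF \<open>i \<le> n\<close>] by (simp only: mult_ac)
  qed
  finally show ?thesis ..
qed

section \<open>Gauss's theorem at unit argument\<close>

lemma add_of_nat_notin_nonpos_Ints:
  fixes z :: "'a::ring_char_0"
  assumes "z \<notin> \<int>\<^sub>\<le>\<^sub>0"
  shows "z + of_nat k \<notin> \<int>\<^sub>\<le>\<^sub>0"
proof
  assume "z + of_nat k \<in> \<int>\<^sub>\<le>\<^sub>0"
  then obtain m where "z + of_nat k = - of_nat m" by (elim nonpos_Ints_cases')
  then have "z = - of_nat (m + k)" by (simp add: algebra_simps eq_neg_iff_add_eq_0)
  then show False using assms minus_of_nat_in_nonpos_Ints by metis
qed

lemma Re_pos_notin_nonpos_Ints: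
  fixes z :: complex
  assumes "Re z > 0"
  shows "z \<notin> \<int>\<^sub>\<le>\<^sub>0"
  using assms by (auto elim!: nonpos_Ints_cases')

definition gauss_term :: "'a::field_char_0 \<Rightarrow> 'a \<Rightarrow> 'a \<Rightarrow> nat \<Rightarrow> 'a" where
  "gauss_term a b c n = pochhammer a n * pochhammer b n / (pochhammer c n * fact n)"

text \<open>Euler's product for \<open>1/\<Gamma>\<close> says \<open>(z)\<^sub>n\<^sub>+\<^sub>1 \<sim> n! n\<^sup>z / \<Gamma>(z)\<close>, so the terms are of order
  \<open>n\<^sup>a\<^sup>+\<^sup>b\<^sup>-\<^sup>c\<^sup>-\<^sup>1\<close>. The factor \<open>n!\<close> of the denominator is \<open>(1)\<^sub>n\<close> and is treated likewise.\<close>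

lemma gauss_term_Suc_bound:
  fixes a b c :: complex
  assumes "c \<notin> \<int>\<^sub>\<le>\<^sub>0"
  shows "\<exists>K. \<forall>n\<ge>1. norm (gauss_term a b c (Suc n)) \<le> K * real n powr (Re (a + b - c) - 1)"
proof -
  define q where "q n = rGamma_series a n * rGamma_series b n /
    (rGamma_series c n * rGamma_series 1 n)" for n
  have "rGamma c \<noteq> 0" using assms by (simp add: rGamma_eq_zero_iff)
  then have "q \<longlonglongrightarrow> rGamma a * rGamma b / (rGamma c * rGamma 1)"
    unfolding q_def by (intro tendsto_intros) auto
  then have "Bseq q" by (intro convergent_imp_Bseq convergentI)
  then obtain K where K: "\<And>n. norm (q n) \<le> K" unfolding Bseq_def by blast
  have "norm (gauss_term a b c (Suc n)) \<le> K * real n powr (Re (a + b - c) - 1)" if "n \<ge> 1" for n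
  proof -
    let ?L = "of_real (ln (real n)) :: complex"
    have "pochhammer c (Suc n) \<noteq> 0"
      using assms by (auto dest: pochhammer_eq_0_imp_nonpos_Int)
    then have "gauss_term a b c (Suc n) = q n * exp ((a + b - c - 1) * ?L)"
      by (simp add: gauss_term_def q_def rGamma_series_def exp_diff exp_add ring_distribs
          pochhammer_fact[symmetric] field_simps del: fact_Suc)
    moreover have "norm (exp ((a + b - c - 1) * ?L)) = real n powr (Re (a + b - c) - 1)"
      using that by (simp add: powr_def algebra_simps)
    ultimately show ?thesis
      using K[of n] by (simp add: norm_mult mult_right_mono)
  qed
  then show ?thesis by blast
qed

lemma summable_norm_gauss_term:
  fixes a b c :: complex
  assumes "c \<notin> \<int>\<^sub>\<le>\<^sub>0" "Re (c - a - b) > 0"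
  shows "summable (\<lambda>n. norm (gauss_term a b c n))"
proof -
  obtain K where K: "\<And>n. n \<ge> 1 \<Longrightarrow> norm (gauss_term a b c (Suc n)) \<le> K * real n powr (Re (a + b - c) - 1)"
    using gauss_term_Suc_bound[OF assms(1)] by blast
  have "summable (\<lambda>n. K * real n powr (Re (a + b - c) - 1))"
    using assms(2) by (intro summable_mult) (simp add: summable_real_powr_iff)
  then have "summable (\<lambda>n. norm (gauss_term a b c (Suc n)))"
    by (rule summable_comparison_test'[where N = 1]) (use K in auto)
  then show ?thesis by (subst (asm) summable_Suc_iff)
qed

lemma tendsto_of_nat_times_gauss_term:
  fixes a b c :: complex
  assumes "c \<notin> \<int>\<^sub>\<le>\<^sub>0" "Re (c - a - b) > 0"
  shows "(\<lambda>n. of_nat n * gauss_term a b c n) \<longlonglongrightarrow> 0"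
proof -
  define s where "s = Re (c - a - b)"
  have s: "s > 0" using assms(2) by (simp add: s_def)
  obtain K where K: "\<And>n. n \<ge> 1 \<Longrightarrow> norm (gauss_term a b c (Suc n)) \<le> K * real n powr (Re (a + b - c) - 1)"
    using gauss_term_Suc_bound[OF assms(1)] by blast
  have "(\<lambda>n. of_nat (Suc n) * gauss_term a b c (Suc n)) \<longlonglongrightarrow> 0"
  proof (rule Lim_null_comparison)
    show "\<forall>\<^sub>F n in sequentially. norm (of_nat (Suc n) * gauss_term a b c (Suc n)) \<le>
        2 * (K * real n powr (- s))"
      using eventually_ge_at_top[of 1]
    proof eventually_elim
      case (elim n)
      have "norm (of_nat (Suc n) * gauss_term a b c (Suc n)) \<le>
          (2 * real n) * (K * real n powr (- s - 1))"
        using elim K[of n] unfolding norm_mult norm_of_nat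
        by (intro mult_mono) (auto simp: s_def algebra_simps)
      also have "\<dots> = 2 * (K * (real n powr 1 * real n powr (- s - 1)))"
        using elim by simp
      also have "\<dots> = 2 * (K * real n powr (- s))"
        by (subst powr_add[symmetric]) simp
      finally show ?case .
    qed
    have "(\<lambda>n. real n powr (- s)) \<longlonglongrightarrow> 0"
      using s by (intro tendsto_neg_powr filterlim_real_sequentially) auto
    then show "(\<lambda>n. 2 * (K * real n powr (- s))) \<longlonglongrightarrow> 0"
      by (intro tendsto_mult_right_zero)
  qed
  then show ?thesis by (subst (asm) filterlim_sequentially_Suc)
qed

text \<open>Termwise, the difference of the two sides is \<open>U (n + 1) - U n\<close> with \<open>U n = - c n t\<^sub>n\<close>, where \<open>t\<^sub>n\<close> is
  the term for \<open>a, b; c\<close>. It telescopes to \<open>0\<close> because \<open>n t\<^sub>n\<close> tends to \<open>0\<close>.\<close>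

lemma gauss_contiguous:
  fixes a b c :: complex
  assumes "c \<notin> \<int>\<^sub>\<le>\<^sub>0" "Re (c - a - b) > 0"
  shows "c * (c - a - b) * suminf (gauss_term a b c) =
    (c - a) * (c - b) * suminf (gauss_term a b (c + 1))"
proof -
  have c1: "c + 1 \<notin> \<int>\<^sub>\<le>\<^sub>0"
    using add_of_nat_notin_nonpos_Ints[OF assms(1), of 1] by simp
  have sums: "gauss_term a b c' sums suminf (gauss_term a b c')" if "c' = c \<or> c' = c + 1" for c'
    using that assms c1
    by (intro summable_sums[OF summable_norm_cancel[OF summable_norm_gauss_term]]) auto
  define U where "U n = - c * (of_nat n * gauss_term a b c n)" for n
  have tel: "c * (c - a - b) * gauss_term a b c n - (c - a) * (c - b) * gauss_term a b (c + 1) n =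
      U (Suc n) - U n" for n
  proof -
    have nz: "c + of_nat k \<noteq> 0" for k
      using add_of_nat_notin_nonpos_Ints[OF assms(1), of k] by auto
    have "c * pochhammer (c + 1) n = pochhammer c n * (c + of_nat n)"
      by (simp only: pochhammer_Suc[symmetric] pochhammer_rec[symmetric])
    then have "pochhammer (c + 1) n = pochhammer c n * (c + of_nat n) / c"
      using nz[of 0] by (simp add: nonzero_eq_divide_eq mult.commute)
    then have q: "gauss_term a b (c + 1) n = gauss_term a b c n * c / (c + of_nat n)"
      by (simp add: gauss_term_def)
    have r: "of_nat (Suc n) * gauss_term a b c (Suc n) =
        gauss_term a b c n * (a + of_nat n) * (b + of_nat n) / (c + of_nat n)"
      using of_nat_neq_0[of n, where ?'a = complex]
      by (simp add: gauss_term_def pochhammer_Suc fact_Suc mult_ac del: of_nat_Suc)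
    define t where "t = gauss_term a b c n"
    define z where "z = c + of_nat n"
    have z: "z \<noteq> 0" using nz[of n] by (simp add: z_def)
    have "c * (c - a - b) * t - (c - a) * (c - b) * (t * c / z) =
        c * t / z * ((c - a - b) * z - (c - a) * (c - b))"
      using z by (simp add: right_diff_distrib mult_ac)
    also have "(c - a - b) * z - (c - a) * (c - b) = z * of_nat n - (a + of_nat n) * (b + of_nat n)"
      by (simp add: z_def algebra_simps)
    also have "c * t / z * \<dots> = - c * (t * (a + of_nat n) * (b + of_nat n) / z) - (- c * (of_nat n * t))"
      using z by (simp add: right_diff_distrib mult_ac)
    finally show ?thesis
      unfolding U_def r q t_def z_def .
  qed
  have "U \<longlonglongrightarrow> 0"
    unfolding U_def by (intro tendsto_mult_right_zero tendsto_of_nat_times_gauss_term assms)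
  then have "(\<lambda>n. U (Suc n) - U n) sums (0 - U 0)"
    by (rule telescope_sums)
  then have A: "(\<lambda>n. U (Suc n) - U n) sums 0"
    by (simp add: U_def)
  have B: "(\<lambda>n. c * (c - a - b) * gauss_term a b c n - (c - a) * (c - b) * gauss_term a b (c + 1) n) sums
      (c * (c - a - b) * suminf (gauss_term a b c) - (c - a) * (c - b) * suminf (gauss_term a b (c + 1)))"
    by (intro sums_diff sums_mult sums) auto
  show ?thesis
    using sums_unique2[OF B[unfolded tel] A] by simp
qed

lemma norm_pochhammer_le: "norm (pochhammer z n) \<le> pochhammer (norm z) n"
  for z :: "'a::real_normed_field"
proof (induction n)
  case (Suc n)
  have "norm (z + of_nat n) \<le> norm z + of_nat n"
    using norm_triangle_ineq[of z "of_nat n"] by simp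
  moreover have "0 \<le> pochhammer (norm z) n"
    by (simp add: pochhammer_prod prod_nonneg)
  ultimately show ?case
    using Suc by (simp add: pochhammer_Suc norm_mult mult_mono)
qed simp

lemma norm_pochhammer_ge:
  fixes z :: complex
  assumes "Re z > 0"
  shows "pochhammer (Re z) n \<le> norm (pochhammer z n)"
proof (induction n)
  case (Suc n)
  have "Re z + of_nat n \<le> norm (z + of_nat n)"
    using complex_Re_le_cmod[of "z + of_nat n"] by simp
  then show ?case
    using Suc assms by (simp add: pochhammer_Suc norm_mult mult_mono)
qed simp

text \<open>All terms but the first die out. Once \<open>r = Re c + K\<close> exceeds \<open>\<bar>a\<bar> + \<bar>b\<bar>\<close>, the series for
  \<open>c + K + k\<close> is dominated by the convergent positive series for \<open>\<bar>a\<bar>, \<bar>b\<bar>; r\<close>, and since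
  \<open>(r + k) (r)\<^sub>n \<le> r (r + k)\<^sub>n\<close> for \<open>n \<ge> 1\<close>, its tail gains a factor \<open>r / (r + k)\<close>.\<close>

lemma suminf_gauss_term_shift_tendsto:
  fixes a b c :: complex
  shows "(\<lambda>k. suminf (gauss_term a b (c + of_nat k))) \<longlonglongrightarrow> 1"
proof -
  obtain K :: nat where K: "norm a + norm b - Re c < real K"
    using reals_Archimedean2 by blast
  define r where "r = Re c + real K"
  have r: "r > norm a + norm b" using K by (simp add: r_def)
  then have r0: "r > 0" by (smt (verit) norm_ge_zero)
  define T where "T n = gauss_term (norm a) (norm b) r (Suc n)" for n
  have T0: "T n \<ge> 0" for n
    unfolding T_def gauss_term_def using r0
    by (intro divide_nonneg_nonneg mult_nonneg_nonneg prod_nonneg)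
      (auto simp: pochhammer_prod simp del: prod.op_ivl_Suc intro!: prod_nonneg)
  have "summable (\<lambda>n. norm (gauss_term (of_real (norm a)) (of_real (norm b)) (of_real r :: complex) n))"
    using r r0 by (intro summable_norm_gauss_term Re_pos_notin_nonpos_Ints) auto
  then have "summable (\<lambda>n. norm (gauss_term (of_real (norm a)) (of_real (norm b)) (of_real r :: complex) (Suc n)))"
    by (subst summable_Suc_iff)
  moreover have "norm (gauss_term (of_real (norm a)) (of_real (norm b)) (of_real r :: complex) (Suc n)) = T n" for n
  proof -
    have "gauss_term (of_real (norm a)) (of_real (norm b)) (of_real r :: complex) (Suc n) = of_real (T n)"
      by (simp add: gauss_term_def T_def pochhammer_of_real del: fact_Suc)
    then show ?thesis using T0[of n] by simp
  qed
  ultimately have sumT: "summable T" by simp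
  have bound: "norm (suminf (gauss_term a b (c + of_nat (k + K))) - 1) \<le> r * suminf T / (r + real k)" for k
  proof -
    let ?c = "c + of_nat (k + K)"
    have Rec: "Re ?c = r + real k" by (simp add: r_def)
    have le: "norm (gauss_term a b ?c (Suc n)) \<le> r / (r + real k) * T n" for n
    proof -
      have "(r + real k) * pochhammer r (Suc n) \<le> r * pochhammer (r + real k) (Suc n)"
      proof -
        have "pochhammer (r + 1) n \<le> pochhammer (r + real k + 1) n"
          unfolding pochhammer_prod using r0 by (intro prod_mono) auto
        then have "(r + real k) * (r * pochhammer (r + 1) n) \<le> r * ((r + real k) * pochhammer (r + real k + 1) n)"
          using r0 by (simp add: mult_mono)
        then show ?thesis by (simp only: pochhammer_rec)
      qed
      then have "(r + real k) / r * pochhammer r (Suc n) \<le> pochhammer (Re ?c) (Suc n)"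
        unfolding Rec using r0 by (simp add: field_simps)
      also have "\<dots> \<le> norm (pochhammer ?c (Suc n))"
        using r0 Rec by (intro norm_pochhammer_ge) auto
      finally have den: "(r + real k) / r * pochhammer r (Suc n) \<le> norm (pochhammer ?c (Suc n))" .
      have p: "pochhammer r (Suc n) > 0" using r0 by (rule pochhammer_pos)
      have "norm (gauss_term a b ?c (Suc n)) \<le>
          (pochhammer (norm a) (Suc n) * pochhammer (norm b) (Suc n)) /
          ((r + real k) / r * pochhammer r (Suc n) * fact (Suc n))"
        unfolding gauss_term_def norm_divide norm_mult norm_fact
        using r0 p
        by (intro frac_le mult_mono mult_pos_pos norm_pochhammer_le den)
          (auto simp: pochhammer_prod simp del: prod.op_ivl_Suc intro!: prod_nonneg mult_nonneg_nonneg)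
      also have "\<dots> = r / (r + real k) * T n"
        using r0 p by (simp add: T_def gauss_term_def field_simps del: fact_Suc)
      finally show ?thesis .
    qed
    have sumB: "summable (\<lambda>n. r / (r + real k) * T n)"
      using sumT by (rule summable_mult)
    have sumN: "summable (\<lambda>n. norm (gauss_term a b ?c (Suc n)))"
      using sumB by (rule summable_comparison_test'[where N = 0]) (use le in auto)
    have "summable (gauss_term a b ?c)"
      using summable_norm_cancel[OF sumN] by (subst (asm) summable_Suc_iff)
    then have "suminf (gauss_term a b ?c) - 1 = (\<Sum>n. gauss_term a b ?c (Suc n))"
      by (subst suminf_split_head) (auto simp: gauss_term_def)
    also have "norm \<dots> \<le> (\<Sum>n. r / (r + real k) * T n)"
      using le by (intro norm_suminf_le sumB)
    also have "\<dots> = r * suminf T / (r + real k)"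
      using suminf_mult[OF sumT, of "r / (r + real k)"] by simp
    finally show ?thesis .
  qed
  have "(\<lambda>k. r * suminf T / (r + real k)) \<longlonglongrightarrow> 0"
    by (intro real_tendsto_divide_at_top[OF tendsto_const] filterlim_tendsto_add_at_top[OF tendsto_const]
        filterlim_real_sequentially)
  then have "(\<lambda>k. suminf (gauss_term a b (c + of_nat (k + K))) - 1) \<longlonglongrightarrow> 0"
    by (rule Lim_null_comparison[rotated]) (use bound in auto)
  then have "(\<lambda>k. suminf (gauss_term a b (c + of_nat (k + K)))) \<longlonglongrightarrow> 1"
    by (subst (asm) LIM_zero_iff)
  then show ?thesis by (rule LIMSEQ_offset)
qed

text \<open>Iterating the contiguous relation \<open>k\<close> times expresses the sum \<open>F(c)\<close> through \<open>F(c + k)\<close>, which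
  tends to \<open>1\<close>, and Pochhammer symbols. Their quotient is a quotient of Euler products, in which the
  powers of \<open>k\<close> cancel because \<open>c + (c - a - b) = (c - a) + (c - b)\<close>. The factors \<open>1/\<Gamma>\<close> cover
  the case that \<open>c - a\<close> or \<open>c - b\<close> is a pole of \<open>\<Gamma>\<close>.\<close>

lemma gauss_has_sum:
  fixes a b c :: complex
  assumes "c \<notin> \<int>\<^sub>\<le>\<^sub>0" "Re (c - a - b) > 0"
  shows "(gauss_term a b c has_sum
    Gamma c * Gamma (c - a - b) * rGamma (c - a) * rGamma (c - b)) UNIV"
proof -
  let ?F = "\<lambda>c. suminf (gauss_term a b c)"
  have iter: "pochhammer c k * pochhammer (c - a - b) k * ?F c =
      pochhammer (c - a) k * pochhammer (c - b) k * ?F (c + of_nat k)" for k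
  proof (induction k)
    case (Suc k)
    let ?c = "c + of_nat k"
    have step: "?c * (?c - a - b) * ?F ?c = (?c - a) * (?c - b) * ?F (?c + 1)"
      using assms by (intro gauss_contiguous add_of_nat_notin_nonpos_Ints) auto
    have "pochhammer c (Suc k) * pochhammer (c - a - b) (Suc k) * ?F c =
        ?c * (?c - a - b) * (pochhammer c k * pochhammer (c - a - b) k * ?F c)"
      by (simp add: pochhammer_Suc algebra_simps)
    also have "\<dots> = pochhammer (c - a) k * pochhammer (c - b) k * (?c * (?c - a - b) * ?F ?c)"
      unfolding Suc.IH by (simp only: mult_ac)
    also have "\<dots> = pochhammer (c - a) (Suc k) * pochhammer (c - b) (Suc k) * ?F (?c + 1)"
      unfolding step by (simp add: pochhammer_Suc algebra_simps)
    finally show ?case by (simp add: algebra_simps)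
  qed simp
  have eq: "rGamma_series c k * rGamma_series (c - a - b) k * ?F c =
      rGamma_series (c - a) k * rGamma_series (c - b) k * ?F (c + of_nat (Suc k))" for k
  proof -
    define L where "L = (of_real (ln (real k)) :: complex)"
    have "exp (c * L) * exp ((c - a - b) * L) = exp ((c - a) * L) * exp ((c - b) * L)"
      by (simp add: exp_add[symmetric] algebra_simps)
    then show ?thesis
      using iter[of "Suc k"] unfolding rGamma_series_def Suc_eq_plus1 L_def[symmetric]
      by (simp add: field_simps)
  qed
  have "(\<lambda>k. rGamma_series c k * rGamma_series (c - a - b) k * ?F c) \<longlonglongrightarrow>
      rGamma c * rGamma (c - a - b) * ?F c"
    by (intro tendsto_intros)
  moreover have "(\<lambda>k. rGamma_series (c - a) k * rGamma_series (c - b) k * ?F (c + of_nat (Suc k))) \<longlonglongrightarrow>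
      rGamma (c - a) * rGamma (c - b) * 1"
    by (intro tendsto_intros LIMSEQ_Suc[OF suminf_gauss_term_shift_tendsto])
  ultimately have lim: "rGamma c * rGamma (c - a - b) * ?F c = rGamma (c - a) * rGamma (c - b)"
    unfolding eq using LIMSEQ_unique by fastforce
  have "c - a - b \<notin> \<int>\<^sub>\<le>\<^sub>0"
    using assms(2) by (rule Re_pos_notin_nonpos_Ints)
  then have "rGamma c * Gamma c = 1" "rGamma (c - a - b) * Gamma (c - a - b) = 1"
    using assms(1) by (simp_all add: rGamma_inverse_Gamma Gamma_eq_zero_iff)
  then have "?F c = Gamma c * Gamma (c - a - b) * (rGamma c * rGamma (c - a - b) * ?F c)"
    by (simp add: mult_ac)
  then have "?F c = Gamma c * Gamma (c - a - b) * rGamma (c - a) * rGamma (c - b)"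
    unfolding lim by (simp add: mult_ac)
  moreover have "(gauss_term a b c has_sum ?F c) UNIV"
    using summable_norm_gauss_term[OF assms]
    by (intro norm_summable_imp_has_sum summable_sums[OF summable_norm_cancel])
  ultimately show ?thesis by simp
qed

text \<open>The terms with \<open>n < j\<close> vanish, and term \<open>n + j\<close> is a constant multiple of term \<open>n\<close> of the Gauss
  series for \<open>a + j, b + j; c + j\<close>. There \<open>c - a\<close> and \<open>c - b\<close> are unchanged and \<open>c - a - b\<close> drops by
  \<open>j\<close>; the reflected symbol \<open>(1 + a + b - c)\<^sub>j\<close> records this drop.\<close>

lemma gauss_binomial_moment_has_sum:
  fixes a b c :: complex
  assumes c: "c \<notin> \<int>\<^sub>\<le>\<^sub>0" and j: "Re (c - a - b) > real j"
  shows "((\<lambda>n. of_nat (n choose j) * gauss_term a b c n) has_sum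
    (-1) ^ j * pochhammer a j * pochhammer b j / (pochhammer (1 + a + b - c) j * fact j) *
    (Gamma c * Gamma (c - a - b) * rGamma (c - a) * rGamma (c - b))) UNIV" (is "(?f has_sum ?S) _")
proof -
  define s where "s = c - a - b"
  have cj: "c + of_nat j \<notin> \<int>\<^sub>\<le>\<^sub>0"
    using c by (rule add_of_nat_notin_nonpos_Ints)
  have sj: "s - of_nat j \<notin> \<int>\<^sub>\<le>\<^sub>0"
    using j by (intro Re_pos_notin_nonpos_Ints) (simp add: s_def)
  have pc: "pochhammer c n \<noteq> 0" for n
    using c by (auto dest: pochhammer_eq_0_imp_nonpos_Int)
  have ps: "pochhammer (s - of_nat j) j \<noteq> 0"
    using sj by (auto dest: pochhammer_eq_0_imp_nonpos_Int)
  have Gc: "Gamma (c + of_nat j) = pochhammer c j * Gamma c"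
    using pochhammer_Gamma[OF c, of j] c by (simp add: Gamma_eq_zero_iff field_simps)
  have Gs: "Gamma s = pochhammer (s - of_nat j) j * Gamma (s - of_nat j)"
    using pochhammer_Gamma[OF sj, of j] sj by (simp add: Gamma_eq_zero_iff field_simps)
  have reflect: "pochhammer (1 + a + b - c) j = (-1) ^ j * pochhammer (s - of_nat j) j"
    using pochhammer_minus[of "s - 1" j] by (simp add: s_def algebra_simps)
  let ?C = "pochhammer a j * pochhammer b j / (pochhammer c j * fact j)"
  have shift: "?f (n + j) = ?C * gauss_term (a + of_nat j) (b + of_nat j) (c + of_nat j) n" for n
  proof -
    have "of_nat ((n + j) choose j) = (fact (n + j) / (fact j * fact n) :: complex)"
      by (subst binomial_fact) auto
    then show ?thesis
      using pochhammer_product'[of a j n] pochhammer_product'[of b j n] pochhammer_product'[of c j n]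
        pc[of "j + n"]
      by (simp add: gauss_term_def add.commute field_simps)
  qed
  have "(gauss_term (a + of_nat j) (b + of_nat j) (c + of_nat j) has_sum
      Gamma (c + of_nat j) * Gamma (s - of_nat j) * rGamma (c - a) * rGamma (c - b)) UNIV"
    using gauss_has_sum[OF cj, of "a + of_nat j" "b + of_nat j"] j
    by (simp add: s_def algebra_simps)
  then have "((\<lambda>n. ?f (n + j)) has_sum
      ?C * (Gamma (c + of_nat j) * Gamma (s - of_nat j) * rGamma (c - a) * rGamma (c - b))) UNIV"
    unfolding shift by (rule has_sum_cmult_right)
  also have "?C * (Gamma (c + of_nat j) * Gamma (s - of_nat j) * rGamma (c - a) * rGamma (c - b)) = ?S"
    unfolding Gc reflect s_def[symmetric] Gs using pc[of j] ps by (simp add: field_simps)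
  also have "((\<lambda>n. ?f (n + j)) has_sum ?S) UNIV \<longleftrightarrow> (?f has_sum ?S) {j..}"
    by (intro has_sum_reindex_bij_witness[of _ "\<lambda>n. n - j" "\<lambda>n. n + j"]) auto
  also have "\<dots> \<longleftrightarrow> (?f has_sum ?S) UNIV"
    by (intro has_sum_cong_neutral) auto
  finally show ?thesis .
qed

section \<open>The double series\<close>

text \<open>Two parameters are reflected: \<open>(-N)\<^sub>m\<close> becomes a binomial coefficient, and \<open>1 / (1 - N - \<delta>)\<^sub>m\<close> becomes
  \<open>(\<delta>)\<^sub>N\<^sub>-\<^sub>m / (\<delta>)\<^sub>N\<close>, up to signs that cancel. The latter also shows that \<open>(\<delta>)\<^sub>N\<close> is not \<open>0\<close>.
  This puts the sum over \<open>m\<close> in the polynomial form of the Pfaff-Saalschuetz sum.\<close>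

lemma kampe_de_feriet_term_eq_polynomial_times_gauss_term:
  fixes b c d e' :: complex and N m n :: nat
  defines "\<delta> \<equiv> d - b - c"
  assumes m: "m \<le> N" and d: "d \<notin> \<int>\<^sub>\<le>\<^sub>0" and e: "1 - of_nat N + b + c - d \<notin> \<int>\<^sub>\<le>\<^sub>0"
  shows "kampe_de_feriet_term d (- of_nat N) b c (1 - of_nat N + b + c - d)
      (d + of_nat N) (d - b) (d - c) e' 1 1 (m, n) =
    of_nat (N choose m) * pochhammer b m * pochhammer c m * pochhammer \<delta> (N - m) /
      (pochhammer \<delta> N * pochhammer d N) *
      pochhammer (d + of_nat m + of_nat n) (N - m) * gauss_term (d - b) (d - c) e' n"
proof -
  let ?e = "1 - of_nat N + b + c - d"
  have pd: "pochhammer d k \<noteq> 0" for k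
    using d by (auto dest: pochhammer_eq_0_imp_nonpos_Int)
  have pe: "pochhammer ?e k \<noteq> 0" for k
    using e by (auto dest: pochhammer_eq_0_imp_nonpos_Int)
  have reflect: "pochhammer ?e k = (-1) ^ k * pochhammer (\<delta> + of_nat (N - k)) k" if "k \<le> N" for k
    using pochhammer_minus[of "\<delta> + of_nat N - 1" k] that
    by (simp add: \<delta>_def of_nat_diff algebra_simps)
  have pdel: "pochhammer \<delta> N \<noteq> 0"
    using pe[of N] reflect[of N] by simp
  have "pochhammer \<delta> N = pochhammer \<delta> (N - m) * pochhammer (\<delta> + of_nat (N - m)) m"
    using pochhammer_product'[of \<delta> "N - m" m] m by simp
  then have e_eq: "pochhammer \<delta> N = (-1) ^ m * pochhammer \<delta> (N - m) * pochhammer ?e m"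
    using reflect[OF m] by simp
  have N_eq: "pochhammer (- of_nat N :: complex) m = (-1) ^ m * (of_nat (N choose m) * fact m)"
    by (simp add: binomial_gbinomial gbinomial_pochhammer)
  have "pochhammer d (m + n) * pochhammer (d + of_nat (m + n)) (N - m) =
      pochhammer d N * pochhammer (d + of_nat N) n"
    using pochhammer_product'[of d "m + n" "N - m"] pochhammer_product'[of d N n] m
    by (simp add: add.commute)
  then have d_eq: "pochhammer (d + of_nat N) n / pochhammer d (m + n) =
      pochhammer (d + of_nat m + of_nat n) (N - m) / pochhammer d N"
    using pd[of "m + n"] pd[of N] by (simp add: frac_eq_eq mult.commute add.assoc)
  have del_eq: "1 / pochhammer ?e m = (-1) ^ m * pochhammer \<delta> (N - m) / pochhammer \<delta> N"
    unfolding e_eq using pe[of m] pdel[unfolded e_eq] by simp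
  have "kampe_de_feriet_term d (- of_nat N) b c ?e (d + of_nat N) (d - b) (d - c) e' 1 1 (m, n) =
      pochhammer (- of_nat N) m / fact m * (pochhammer b m * pochhammer c m) * (1 / pochhammer ?e m) *
      (pochhammer (d + of_nat N) n / pochhammer d (m + n)) * gauss_term (d - b) (d - c) e' n"
    by (simp add: kampe_de_feriet_term_def gauss_term_def mult_ac)
  then show ?thesis
    unfolding N_eq del_eq d_eq by (simp add: mult_ac)
qed

text \<open>After exchanging the sums, the inner one is the Pfaff-Saalschuetz sum of degree \<open>N - j\<close> with
  \<open>c\<close> replaced by \<open>d + j\<close>. Its value \<open>(d + j - b)\<^sub>N\<^sub>-\<^sub>j (d + j - c)\<^sub>N\<^sub>-\<^sub>j\<close> completes the factors
  \<open>(d - b)\<^sub>j (d - c)\<^sub>j\<close> of the weights to symbols of length \<open>N\<close>, so the dependence on \<open>j\<close>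
  that is left is that of a Chu-Vandermonde sum.\<close>

lemma double_sum_identity:
  fixes b c d \<sigma> :: "'a::field_char_0" and N :: nat
  defines "\<delta> \<equiv> d - b - c"
  assumes nz: "pochhammer \<sigma> N \<noteq> 0"
  shows "(\<Sum>m\<le>N. of_nat (N choose m) * pochhammer b m * pochhammer c m * pochhammer \<delta> (N - m) *
      (\<Sum>j\<le>N - m. of_nat ((N - m) choose j) * pochhammer (d + of_nat m + of_nat j) (N - m - j) *
        ((-1) ^ j * pochhammer (d - b) j * pochhammer (d - c) j / pochhammer \<sigma> j))) =
    pochhammer (d - b) N * pochhammer (d - c) N * pochhammer (\<sigma> - \<delta>) N / pochhammer \<sigma> N"
    (is "?lhs = ?rhs")
proof -
  define w where "w j = (-1) ^ j * pochhammer (d - b) j * pochhammer (d - c) j / pochhammer \<sigma> j" for j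
  define g where "g m j = of_nat ((N choose m) * ((N - m) choose j)) * pochhammer b m * pochhammer c m *
      pochhammer \<delta> (N - m) * pochhammer (d + of_nat m + of_nat j) (N - m - j) * w j" for m j
  have inner: "(\<Sum>m\<le>N - j. g m j) = pochhammer (d - b) N * pochhammer (d - c) N *
      ((-1) ^ j * of_nat (N choose j) * pochhammer \<delta> j * pochhammer (\<sigma> + of_nat j) (N - j)) / pochhammer \<sigma> N"
    if "j \<le> N" for j
  proof -
    have "g m j = of_nat (N choose j) * pochhammer \<delta> j * w j *
        (of_nat ((N - j) choose m) * pochhammer b m * pochhammer c m *
          pochhammer (d + of_nat j + of_nat m) (N - j - m) *
          pochhammer (d + of_nat j - b - c) (N - j - m))" if m: "m \<le> N - j" for m
    proof -
      have "(N choose m) * ((N - m) choose j) = (N choose (m + j)) * ((m + j) choose m)"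
        using choose_mult[of m "m + j" N] m \<open>j \<le> N\<close> by simp
      also have "\<dots> = (N choose (m + j)) * ((m + j) choose j)"
        by (metis add_diff_cancel_left' binomial_symmetric le_add1)
      also have "\<dots> = (N choose j) * ((N - j) choose m)"
        using choose_mult[of j "m + j" N] m \<open>j \<le> N\<close> by simp
      finally have bin: "(N choose m) * ((N - m) choose j) = (N choose j) * ((N - j) choose m)" .
      have del: "pochhammer \<delta> (N - m) = pochhammer \<delta> j * pochhammer (d + of_nat j - b - c) (N - j - m)"
        using pochhammer_product'[of \<delta> j "N - j - m"] m \<open>j \<le> N\<close>
        by (simp add: \<delta>_def algebra_simps)
      have "N - m - j = N - j - m" "d + of_nat m + of_nat j = d + of_nat j + of_nat m"
        by simp_all
      then show ?thesis
        unfolding g_def bin del of_nat_mult by (simp only: mult_ac)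
    qed
    then have "(\<Sum>m\<le>N - j. g m j) = of_nat (N choose j) * pochhammer \<delta> j * w j *
        (\<Sum>m\<le>N - j. of_nat ((N - j) choose m) * pochhammer b m * pochhammer c m *
          pochhammer (d + of_nat j + of_nat m) (N - j - m) *
          pochhammer (d + of_nat j - b - c) (N - j - m))"
      unfolding sum_distrib_left by (intro sum.cong) simp_all
    also have "\<dots> = of_nat (N choose j) * pochhammer \<delta> j * w j *
        (pochhammer (d + of_nat j - b) (N - j) * pochhammer (d + of_nat j - c) (N - j))"
      by (simp only: saalschuetz_polynomial)
    also have "\<dots> = ((-1) ^ j * of_nat (N choose j) * pochhammer \<delta> j / pochhammer \<sigma> j) *
        (pochhammer (d - b) j * pochhammer (d + of_nat j - b) (N - j)) *
        (pochhammer (d - c) j * pochhammer (d + of_nat j - c) (N - j))"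
      by (simp add: w_def mult_ac)
    also have "pochhammer (d - b) j * pochhammer (d + of_nat j - b) (N - j) = pochhammer (d - b) N"
      using pochhammer_product[OF that, of "d - b"] by (simp add: algebra_simps)
    also have "pochhammer (d - c) j * pochhammer (d + of_nat j - c) (N - j) = pochhammer (d - c) N"
      using pochhammer_product[OF that, of "d - c"] by (simp add: algebra_simps)
    also have "(-1) ^ j * of_nat (N choose j) * pochhammer \<delta> j / pochhammer \<sigma> j =
        (-1) ^ j * of_nat (N choose j) * pochhammer \<delta> j * pochhammer (\<sigma> + of_nat j) (N - j) / pochhammer \<sigma> N"
      using nz pochhammer_product[OF that, of \<sigma>] by simp
    finally show ?thesis by (simp add: mult_ac)
  qed
  have "?lhs = (\<Sum>m\<le>N. \<Sum>j\<le>N - m. g m j)"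
    by (simp add: g_def w_def sum_distrib_left mult_ac)
  also have "\<dots> = (\<Sum>j\<le>N. \<Sum>m\<le>N - j. g m j)"
    unfolding sum.Sigma[OF finite_atMost ballI[OF finite_atMost]]
    by (intro sum.reindex_bij_witness[of _ "\<lambda>(j, m). (m, j)" "\<lambda>(m, j). (j, m)"]) auto
  also have "\<dots> = (\<Sum>j\<le>N. pochhammer (d - b) N * pochhammer (d - c) N / pochhammer \<sigma> N *
      ((-1) ^ j * of_nat (N choose j) * pochhammer \<delta> j * pochhammer (\<sigma> + of_nat j) (N - j)))"
    by (intro sum.cong refl) (simp add: inner)
  also have "\<dots> = ?rhs"
    by (simp add: pochhammer_diff_sum[of \<sigma> \<delta> N] sum_distrib_left sum_divide_distrib)
  finally show ?thesis .
qed

lemma has_sum_sum: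
  fixes f :: "'i \<Rightarrow> 'a \<Rightarrow> 'b::topological_comm_monoid_add"
  assumes "\<And>i. i \<in> I \<Longrightarrow> (f i has_sum S i) A"
  shows "((\<lambda>x. \<Sum>i\<in>I. f i x) has_sum (\<Sum>i\<in>I. S i)) A"
  using assms by (induction I rule: infinite_finite_induct) (auto intro!: has_sum_add)

lemma has_sum_finite_rows:
  fixes f :: "'a \<times> 'b \<Rightarrow> 'c::{topological_comm_monoid_add}"
  assumes "finite M" and "\<And>m. m \<in> M \<Longrightarrow> ((\<lambda>n. f (m, n)) has_sum S m) UNIV"
    and "\<And>m n. m \<notin> M \<Longrightarrow> f (m, n) = 0"
  shows "(f has_sum (\<Sum>m\<in>M. S m)) UNIV"
proof -
  have "(f has_sum (\<Sum>m\<in>M. S m)) (M \<times> UNIV)"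
    using assms(1,2)
  proof (induction M rule: finite_induct)
    case (insert m M)
    have "(f has_sum S m) ({m} \<times> UNIV)"
    proof -
      have "((\<lambda>n. f (m, n)) has_sum S m) UNIV \<longleftrightarrow> (f has_sum S m) ({m} \<times> UNIV)"
        by (intro has_sum_reindex_bij_witness[of _ snd "Pair m"]) auto
      then show ?thesis using insert.prems by simp
    qed
    then have "(f has_sum (S m + (\<Sum>m\<in>M. S m))) ({m} \<times> UNIV \<union> M \<times> UNIV)"
      using insert by (intro has_sum_Un_disjoint) auto
    moreover have "{m} \<times> (UNIV :: 'b set) \<union> M \<times> UNIV = insert m M \<times> UNIV" by auto
    ultimately show ?case using insert by simp
  qed auto
  also have "?this \<longleftrightarrow> (f has_sum (\<Sum>m\<in>M. S m)) UNIV"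
    using assms(3) by (intro has_sum_cong_neutral) auto
  finally show ?thesis .
qed

theorem mainTheorem7:
  fixes N :: nat and b c d e' :: complex
  assumes "N > 0"
    and "Re (e' - of_nat N + b + c - 2 * d) > 0"
    and "d \<notin> \<int>\<^sub>\<le>\<^sub>0"
    and "1 - of_nat N + b + c - d \<notin> \<int>\<^sub>\<le>\<^sub>0"
    and "e' \<notin> \<int>\<^sub>\<le>\<^sub>0"
  shows "kampe_de_feriet_term d (- of_nat N) b c (1 - of_nat N + b + c - d)
           (d + of_nat N) (d - b) (d - c) e' 1 1 summable_on UNIV
    \<and> kampe_de_feriet d (- of_nat N) b c (1 - of_nat N + b + c - d)
           (d + of_nat N) (d - b) (d - c) e' 1 1
      = (pochhammer (d - b) N * pochhammer (d - c) N * pochhammer (1 + d - e') N) /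
        (pochhammer d N * pochhammer (d - b - c) N * pochhammer (1 + 2 * d - b - c - e') N) *
        (Gamma e' * Gamma (e' + b + c - 2 * d) *
         (rGamma (e' + b - d) * rGamma (e' + c - d)))"
proof -
  define \<delta> where "\<delta> = d - b - c"
  define \<sigma> where "\<sigma> = 1 + 2 * d - b - c - e'"
  define G where "G = Gamma e' * Gamma (e' + b + c - 2 * d) * (rGamma (e' + b - d) * rGamma (e' + c - d))"
  let ?f = "kampe_de_feriet_term d (- of_nat N) b c (1 - of_nat N + b + c - d)
           (d + of_nat N) (d - b) (d - c) e' 1 1"
  let ?w = "\<lambda>j. (-1) ^ j * pochhammer (d - b) j * pochhammer (d - c) j / pochhammer \<sigma> j"
  let ?S = "\<lambda>m. G / (pochhammer \<delta> N * pochhammer d N) *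
    (of_nat (N choose m) * pochhammer b m * pochhammer c m * pochhammer \<delta> (N - m) *
      (\<Sum>j\<le>N - m. of_nat ((N - m) choose j) * pochhammer (d + of_nat m + of_nat j) (N - m - j) * ?w j))"
  \<comment> \<open>The convergence hypothesis is \<open>Re \<sigma> < 1 - N\<close>, and the zeros of \<open>(\<sigma>)\<^sub>N\<close> are \<open>0, -1, \<dots>, 1 - N\<close>.\<close>
  have nz: "pochhammer \<sigma> N \<noteq> 0"
  proof
    assume "pochhammer \<sigma> N = 0"
    then obtain k where "k < N" "\<sigma> = - of_nat k"
      by (auto simp: pochhammer_eq_0_iff)
    then have "real k + 1 \<le> real N" "Re \<sigma> = - real k" by simp_all
    then show False using assms(2) by (simp add: \<sigma>_def)
  qed
  have moment: "((\<lambda>n. of_nat (n choose j) * gauss_term (d - b) (d - c) e' n) has_sum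
      ?w j / fact j * G) UNIV" if "j \<le> N" for j
  proof -
    have "real j < Re (e' - (d - b) - (d - c))"
      using assms(2) that by simp
    note sum = gauss_binomial_moment_has_sum[OF assms(5) this]
    have eqs: "1 + (d - b) + (d - c) - e' = \<sigma>" "e' - (d - b) - (d - c) = e' + b + c - 2 * d"
      "e' - (d - b) = e' + b - d" "e' - (d - c) = e' + c - d"
      by (simp_all add: \<sigma>_def)
    show ?thesis
      using sum unfolding eqs by (simp add: G_def mult.assoc add.assoc)
  qed
  have row: "((\<lambda>n. ?f (m, n)) has_sum ?S m) UNIV" if "m \<in> {..N}" for m
  proof -
    define K where "K = of_nat (N choose m) * pochhammer b m * pochhammer c m * pochhammer \<delta> (N - m) /
      (pochhammer \<delta> N * pochhammer d N)"
    define p where "p j = of_nat ((N - m) choose j) * fact j * pochhammer (d + of_nat m + of_nat j) (N - m - j)" for j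
    have "((\<lambda>n. K * (\<Sum>j\<le>N - m. p j * (of_nat (n choose j) * gauss_term (d - b) (d - c) e' n))) has_sum
        K * (\<Sum>j\<le>N - m. p j * (?w j / fact j * G))) UNIV"
      by (intro has_sum_cmult_right has_sum_sum moment) auto
    also have "K * (\<Sum>j\<le>N - m. p j * (?w j / fact j * G)) = ?S m"
      by (simp add: K_def p_def sum_distrib_left mult_ac)
    also have "(\<lambda>n. K * (\<Sum>j\<le>N - m. p j * (of_nat (n choose j) * gauss_term (d - b) (d - c) e' n))) =
        (\<lambda>n. ?f (m, n))"
    proof
      fix n
      have "pochhammer (d + of_nat m + of_nat n) (N - m) = (\<Sum>j\<le>N - m. p j * of_nat (n choose j))"
        unfolding pochhammer_add_of_nat_sum[of "d + of_nat m" n "N - m"] p_def by (simp add: mult_ac)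
      then have "?f (m, n) = K * (\<Sum>j\<le>N - m. p j * of_nat (n choose j)) * gauss_term (d - b) (d - c) e' n"
        using kampe_de_feriet_term_eq_polynomial_times_gauss_term[of m N d b c e' n] that assms(3,4)
        unfolding K_def \<delta>_def by simp
      then show "K * (\<Sum>j\<le>N - m. p j * (of_nat (n choose j) * gauss_term (d - b) (d - c) e' n)) = ?f (m, n)"
        by (simp add: sum_distrib_right mult.assoc)
    qed
    finally show ?thesis .
  qed
  have "(?f has_sum (\<Sum>m\<le>N. ?S m)) UNIV"
  proof (rule has_sum_finite_rows[OF finite_atMost row])
    fix m n assume "m \<notin> {..N}"
    then show "?f (m, n) = 0"
      by (simp add: kampe_de_feriet_term_def pochhammer_of_nat_eq_0_iff)
  qed
  also have "(\<Sum>m\<le>N. ?S m) = G / (pochhammer \<delta> N * pochhammer d N) *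
      (pochhammer (d - b) N * pochhammer (d - c) N * pochhammer (\<sigma> - \<delta>) N / pochhammer \<sigma> N)"
    unfolding sum_distrib_left[symmetric] \<delta>_def
    by (subst double_sum_identity[OF nz]) (rule refl)
  also have "\<sigma> - \<delta> = 1 + d - e'"
    by (simp add: \<sigma>_def \<delta>_def)
  finally have "(?f has_sum pochhammer (d - b) N * pochhammer (d - c) N * pochhammer (1 + d - e') N /
      (pochhammer d N * pochhammer \<delta> N * pochhammer \<sigma> N) * G) UNIV"
    by (simp add: mult_ac)
  then show ?thesis
    unfolding kampe_de_feriet_def \<delta>_def \<sigma>_def G_def
    by (blast intro: infsumI has_sum_imp_summable)
qed

end
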